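(* Let $p$ be a prime and let $f(n)=(a_1n+b_1)(a_2n+b_2)\cdots(a_rn+b_r)$, where $a_i,b_i\in\mathbb{Z}$, $a_i\neq 0$, and $\gcd(a_i,b_i)=1$ for all $1\le i\le r$. Suppose the root $-\frac{b_i}{a_i}$ of each factor is a $p$-adic integer, with $p$-adic expansion $$-\frac{b_i}{a_i}=c_{i,0}+c_{i,1}p+c_{i,2}p^2+\cdots,\qquad 0\le c_{i,j}\le p-1,$$ for $1\le i\le r$ and $j\ge 0$. For any $k\ge 0$, consider a node on the $k$-th level of the $p$-adic valuation tree of $\{\nu_p(f(n))\}_{n\ge 0}$, with terms of the form $d_0+d_1p+d_2p^2+\cdots+d_{k-1}p^{k-1}+np^k$, where $0\le d_j\le p-1$. For each $1\le i\le r$, let $v_i$ be the smallest $j$ with $0\le j<k$ such that $d_j\neq c_{i,j}$, if such a $j$ exists. If for some $1\le i\le r$ no such $j$ exists, then the node is non-terminating. Otherwise, the node is terminating with valuation $$\sum_{i=1}^r v_i.$$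
   Context: For a prime $p$, $\nu_p$ is the usual $p$-adic valuation on $\mathbb{Q}$, with $\nu_p(0)=+\infty$. Valuation tree. Given a sequence of rational numbers $\{S_n\}_{n\ge 0}$, the $p$-adic valuation tree of $\{\nu_p(S_n)\}_{n\ge 0}$ is built as follows. The $0$-th level has a single node, containing all terms of the sequence. A node at level $k$ consists of the terms $S_m$ whose index $m$ has the form $m=c_0+c_1p+\cdots+c_{k-1}p^{k-1}+np^k$, $n\ge 0$, for fixed digits $0\le c_i\le p-1$ (such a node is said to have terms of the form $c_0+\cdots+c_{k-1}p^{k-1}+np^k$). A node is terminating if $\nu_p(S_m)$ has the same value for all terms $S_m$ in the node (this common value is "the valuation" of the node); it is non-terminating if at least two terms in the node have different valuations. A terminating node does not split. A non-terminating node at level $k$ splits into the $p$ nodes at level $k+1$ whose indices are $m=c_0+\cdots+c_{k-1}p^{k-1}+c_kp^k+np^{k+1}$, $n\ge 0$, one for each $0\le c_k\le p-1$. *)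

theory Defs
  imports
    Complex_Main
    "HOL-Computational_Algebra.Primes"
    "HOL-Library.Extended"
begin

text \<open>The valuation takes values in the integers extended by \<^term>\<open>Pinf\<close>. The case distinction
  is needed because the library convention is \<^prop>\<open>multiplicity p 0 = 0\<close>.\<close>

definition padic_val :: "nat \<Rightarrow> rat \<Rightarrow> int extended" where
  "padic_val p x =
     (if x = 0 then Pinf
      else Fin (int (multiplicity (int p) (fst (quotient_of x)))
              - int (multiplicity (int p) (snd (quotient_of x)))))"

definition padic_integer :: "nat \<Rightarrow> rat \<Rightarrow> bool" where
  "padic_integer p x \<longleftrightarrow> 0 \<le> padic_val p x"

text \<open>\<^term>\<open>c\<close> is the digit sequence of the rational number \<^term>\<open>x\<close>, viewed as an element of the
  \<^term>\<open>p\<close>-adic integers: the partial sums of \<open>c 0 + c 1 * p + c 2 * p^2 + \<dots>\<close> converge to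
  \<^term>\<open>x\<close> in the \<^term>\<open>p\<close>-adic metric, that is, the valuation of the difference tends to infinity.\<close>

definition padic_expansion :: "nat \<Rightarrow> rat \<Rightarrow> (nat \<Rightarrow> nat) \<Rightarrow> bool" where
  "padic_expansion p x c \<longleftrightarrow>
     (\<forall>j. c j < p) \<and>
     (\<forall>M :: int. \<forall>\<^sub>F N in sequentially. Fin M \<le> padic_val p (x - of_nat (\<Sum>j<N. c j * p ^ j)))"

text \<open>A node of level \<open>k\<close> is encoded by the list of its digits, of length \<open>k\<close> and with the
  least significant digit first; \<open>node_indices\<close> is the set of indices of its terms.\<close>

definition node_indices :: "nat \<Rightarrow> nat list \<Rightarrow> nat set" where
  "node_indices p ds = {(\<Sum>j<length ds. ds ! j * p ^ j) + n * p ^ length ds | n. True}"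

definition terminating :: "nat \<Rightarrow> (nat \<Rightarrow> rat) \<Rightarrow> nat list \<Rightarrow> bool" where
  "terminating p S ds \<longleftrightarrow>
     (\<forall>m\<in>node_indices p ds. \<forall>m'\<in>node_indices p ds. padic_val p (S m) = padic_val p (S m'))"

definition non_terminating :: "nat \<Rightarrow> (nat \<Rightarrow> rat) \<Rightarrow> nat list \<Rightarrow> bool" where
  "non_terminating p S ds \<longleftrightarrow>
     (\<exists>m\<in>node_indices p ds. \<exists>m'\<in>node_indices p ds. padic_val p (S m) \<noteq> padic_val p (S m'))"

text \<open>Only meaningful for terminating nodes.\<close>

definition node_valuation :: "nat \<Rightarrow> (nat \<Rightarrow> rat) \<Rightarrow> nat list \<Rightarrow> int extended" where
  "node_valuation p S ds = (THE v. \<forall>m\<in>node_indices p ds. padic_val p (S m) = v)"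

inductive_set valuation_tree :: "nat \<Rightarrow> (nat \<Rightarrow> rat) \<Rightarrow> nat list set"
  for p :: nat and S :: "nat \<Rightarrow> rat" where
  root: "[] \<in> valuation_tree p S"
| split: "\<lbrakk>ds \<in> valuation_tree p S; non_terminating p S ds; c < p\<rbrakk>
    \<Longrightarrow> ds @ [c] \<in> valuation_tree p S"

end

theory Submission
  imports Defs
begin

text \<open>
  A factor \<open>a n + b\<close> with \<open>a\<close>, \<open>b\<close> coprime has its root \<open>- b / a\<close> in the \<open>p\<close>-adic integers exactly
  when \<open>p\<close> does not divide \<open>a\<close>. Hence truncating the expansion of the root after \<open>N\<close> digits gives a
  natural number \<open>s\<^sub>N\<close> with \<open>a s\<^sub>N + b\<close> divisible by \<open>p ^ N\<close>
  (\<open>padic_expansion_root_power_dvd\<close>), which replaces the \<open>p\<close>-adic limit by congruences between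
  integers.

  If the digits of a node first differ from those of the root at position \<open>j\<close>, then every index
  \<open>m\<close> of the node satisfies \<open>m - s\<^sub>j\<^sub>+\<^sub>1 = u p ^ j\<close> with \<open>u\<close> not divisible by \<open>p\<close>. Since \<open>a s\<^sub>j\<^sub>+\<^sub>1 + b\<close>
  is divisible by \<open>p ^ (j + 1)\<close> and \<open>p\<close> does not divide \<open>a\<close>, the valuation of
  \<open>a m + b = (a s\<^sub>j\<^sub>+\<^sub>1 + b) + a u p ^ j\<close> is exactly \<open>j\<close> (\<open>multiplicity_linear_first_mismatch\<close>). If this happens for every
  factor, the valuation is constant on the node and is the sum of these \<open>j\<close>.

  If all \<open>k\<close> digits of the node agree with those of some root, the node contains all \<open>s\<^sub>N\<close> with
  \<open>N \<ge> k\<close>, and \<open>p ^ N\<close> divides the value of the product at \<open>s\<^sub>N\<close>, so the valuations on the node are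
  unbounded. As the product has finitely many zeros and the node is infinite, some valuation on the
  node is finite; hence the valuation is not constant.
\<close>

section \<open>The valuation of fractions and integers\<close>

lemma padic_val_of_int_divide:
  fixes x y :: int
  assumes "prime p" "x \<noteq> 0" "y \<noteq> 0"
  shows "padic_val p (of_int x / of_int y) =
    Fin (int (multiplicity (int p) x) - int (multiplicity (int p) y))"
proof -
  define q where "q = (of_int x / of_int y :: rat)"
  obtain n d where nd: "quotient_of q = (n, d)" by force
  have d: "d > 0" using quotient_of_denom_pos[OF nd] .
  have q: "q = of_int n / of_int d" using quotient_of_div[OF nd] .
  have q0: "q \<noteq> 0" using assms by (simp add: q_def)
  then have n: "n \<noteq> 0" using q by auto
  have "(of_int (x * d) :: rat) = of_int (n * y)"
    using q assms d by (simp add: q_def field_simps)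
  then have "x * d = n * y" by (simp only: of_int_eq_iff)
  moreover have "prime_elem (int p)" using assms by simp
  ultimately have "multiplicity (int p) x + multiplicity (int p) d =
      multiplicity (int p) n + multiplicity (int p) y"
    using assms d n by (metis prime_elem_multiplicity_mult_distrib less_irrefl)
  then show ?thesis using q0 nd by (simp add: padic_val_def flip: q_def)
qed

lemma padic_val_of_int:
  "padic_val p (of_int z) = (if z = 0 then Pinf else Fin (int (multiplicity (int p) z)))"
  by (simp add: padic_val_def)

lemma padic_integer_fraction_not_dvd:
  fixes a b :: int
  assumes p: "prime p" and a: "a \<noteq> 0" and ab: "gcd a b = 1"
    and int: "padic_integer p (- (of_int b / of_int a))"
  shows "\<not> int p dvd a"
proof
  assume dvd: "int p dvd a"
  have nu: "\<not> is_unit (int p)" using p by auto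
  have nb: "\<not> int p dvd b" using dvd ab nu by (metis gcd_greatest)
  then have b: "b \<noteq> 0" by auto
  have "multiplicity (int p) a > 0"
    using dvd a nu by (simp add: multiplicity_gt_zero_iff)
  moreover have "multiplicity (int p) (- b) = 0"
    using nb by (simp add: not_dvd_imp_multiplicity_0)
  moreover have "padic_val p (of_int (- b) / of_int a) \<ge> 0"
    using int by (simp add: padic_integer_def)
  ultimately show False
    using padic_val_of_int_divide[OF p, of "- b" a] a b by (simp add: zero_extended_def)
qed

section \<open>Truncated digit expansions\<close>

lemma digit_sum_split:
  fixes e :: "nat \<Rightarrow> nat"
  assumes "N \<le> N'"
  shows "\<exists>t. (\<Sum>j<N'. e j * p ^ j) = (\<Sum>j<N. e j * p ^ j) + t * p ^ N"
  using assms
proof (induction N' rule: dec_induct)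
  case base
  show ?case by (auto intro: exI[of _ 0])
next
  case (step n)
  then obtain t where t: "(\<Sum>j<n. e j * p ^ j) = (\<Sum>j<N. e j * p ^ j) + t * p ^ N" by blast
  have "p ^ n = p ^ (n - N) * p ^ N" using step by (simp flip: power_add)
  then have "(\<Sum>j<Suc n. e j * p ^ j) = (\<Sum>j<N. e j * p ^ j) + (t + e n * p ^ (n - N)) * p ^ N"
    using t by (simp add: algebra_simps)
  then show ?case by blast
qed

text \<open>Convergence only bounds the valuation of \<open>a s\<^sub>K + b\<close> for some large \<open>K\<close>; the bound for \<open>s\<^sub>N\<close>
  follows because \<open>s\<^sub>K\<close> and \<open>s\<^sub>N\<close> are congruent modulo \<open>p ^ N\<close>.\<close>

lemma padic_expansion_root_power_dvd:
  fixes a b :: int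
  assumes p: "prime p" and a: "a \<noteq> 0"
    and exp: "padic_expansion p (- (of_int b / of_int a)) e"
  shows "int p ^ N dvd a * int (\<Sum>j<N. e j * p ^ j) + b"
proof -
  have "\<forall>\<^sub>F K in sequentially.
      Fin (int N) \<le> padic_val p (- (of_int b / of_int a) - of_nat (\<Sum>j<K. e j * p ^ j))"
    using exp unfolding padic_expansion_def by blast
  then obtain K where K: "K \<ge> N"
    "Fin (int N) \<le> padic_val p (- (of_int b / of_int a) - of_nat (\<Sum>j<K. e j * p ^ j))"
    unfolding eventually_sequentially by (meson nle_le)
  define s where "s = (\<Sum>j<K. e j * p ^ j)"
  define x where "x = - (a * int s + b)"
  have "- (of_int b / of_int a) - of_nat s = (of_int x / of_int a :: rat)"
    using a by (simp add: x_def field_simps)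
  then have val: "Fin (int N) \<le> padic_val p (of_int x / of_int a)"
    using K(2) by (simp flip: s_def)
  have "int p ^ N dvd x"
  proof (cases "x = 0")
    case False
    then have "N \<le> multiplicity (int p) x"
      using val padic_val_of_int_divide[OF p False a] by simp
    then show ?thesis by (simp add: multiplicity_dvd')
  qed simp
  then have dvd: "int p ^ N dvd a * int s + b" unfolding x_def by (simp only: dvd_minus_iff)
  obtain t where "s = (\<Sum>j<N. e j * p ^ j) + t * p ^ N"
    using digit_sum_split[OF K(1)] unfolding s_def by blast
  then have "a * int (\<Sum>j<N. e j * p ^ j) + b = (a * int s + b) - int p ^ N * (a * int t)"
    by (simp add: algebra_simps)
  then show ?thesis using dvd by (simp only: dvd_diff dvd_triv_left)
qed

lemma digits_less_if_in_valuation_tree: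
  assumes "d \<in> valuation_tree p S" "j < length d"
  shows "d ! j < p"
  using assms by (induction arbitrary: j rule: valuation_tree.induct)
    (auto simp: nth_append less_Suc_eq)

section \<open>Linear factors on a node\<close>

lemma multiplicity_linear_first_mismatch:
  fixes a b :: int
  assumes p: "prime p" and pa: "\<not> int p dvd a"
    and root: "\<And>N. int p ^ N dvd a * int (\<Sum>i<N. e i * p ^ i) + b"
    and e: "e j < p" and dj: "d ! j < p" and j: "j < length d"
    and ne: "d ! j \<noteq> e j" and eq: "\<And>i. i < j \<Longrightarrow> d ! i = e i"
    and m: "m \<in> node_indices p d"
  shows "a * int m + b \<noteq> 0" "multiplicity (int p) (a * int m + b) = j"
proof -
  obtain n where n: "m = (\<Sum>i<length d. d ! i * p ^ i) + n * p ^ length d"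
    using m unfolding node_indices_def by blast
  obtain t where t: "(\<Sum>i<length d. d ! i * p ^ i) = (\<Sum>i<Suc j. d ! i * p ^ i) + t * p ^ Suc j"
    using digit_sum_split[of "Suc j" "length d" "\<lambda>i. d ! i" p] j by auto
  have pw: "p ^ length d = p ^ (length d - Suc j) * p ^ Suc j"
    using j by (metis power_add le_add_diff_inverse2 Suc_leI)
  define u where "u = t + n * p ^ (length d - Suc j)"
  have "m = (\<Sum>i<Suc j. d ! i * p ^ i) + u * p ^ Suc j"
    unfolding n t pw u_def by (simp add: algebra_simps)
  moreover have "(\<Sum>i<j. d ! i * p ^ i) = (\<Sum>i<j. e i * p ^ i)"
    using eq by (intro sum.cong) auto
  ultimately have m': "m = (\<Sum>i<j. e i * p ^ i) + d ! j * p ^ j + u * p ^ Suc j"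
    by simp
  obtain q where q: "a * int (\<Sum>i<Suc j. e i * p ^ i) + b = int p ^ Suc j * q"
    using root[of "Suc j"] by (elim dvdE)
  define w where "w = a * (int (d ! j) - int (e j)) + int p * (q + a * int u)"
  have "b = int p ^ Suc j * q - a * int (\<Sum>i<Suc j. e i * p ^ i)" using q by linarith
  then have fac: "a * int m + b = int p ^ j * w"
    unfolding m' w_def by (simp add: algebra_simps)
  have "\<not> int p dvd int (d ! j) - int (e j)"
  proof
    assume "int p dvd int (d ! j) - int (e j)"
    then have "int p \<le> \<bar>int (d ! j) - int (e j)\<bar>"
      using ne by (intro zdvd_imp_le) auto
    then show False using e dj by linarith
  qed
  moreover have pp: "prime (int p)" using p by simp
  ultimately have "\<not> int p dvd a * (int (d ! j) - int (e j))"
    using pa prime_dvd_multD by blast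
  then have w: "\<not> int p dvd w"
    unfolding w_def by (simp add: dvd_add_left_iff)
  have p0: "int p \<noteq> 0" using p by auto
  show "a * int m + b \<noteq> 0" using fac w p0 by auto
  show "multiplicity (int p) (a * int m + b) = j"
    unfolding fac using w p0 by (intro multiplicity_eqI) simp_all
qed

lemma digit_sum_in_node:
  assumes "\<And>j. j < length d \<Longrightarrow> d ! j = e j" "length d \<le> N"
  shows "(\<Sum>j<N. e j * p ^ j) \<in> node_indices p d"
proof -
  have "(\<Sum>j<length d. e j * p ^ j) = (\<Sum>j<length d. d ! j * p ^ j)"
    using assms(1) by (intro sum.cong) auto
  then show ?thesis
    using digit_sum_split[OF assms(2), of e p] unfolding node_indices_def by auto
qed

lemma infinite_node_indices:
  assumes "p > 0"
  shows "infinite (node_indices p d)"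
proof -
  have "node_indices p d = range (\<lambda>n. (\<Sum>j<length d. d ! j * p ^ j) + n * p ^ length d)"
    unfolding node_indices_def by blast
  moreover have "inj (\<lambda>n. (\<Sum>j<length d. d ! j * p ^ j) + n * p ^ length d)"
    using assms by (intro injI) simp
  ultimately show ?thesis using finite_imageD infinite_UNIV_nat by metis
qed

lemma finite_zeros_linear_product:
  fixes a b :: "'i \<Rightarrow> int"
  assumes "finite I" "\<And>i. i \<in> I \<Longrightarrow> a i \<noteq> 0"
  shows "finite {m::nat. (\<Prod>i\<in>I. a i * int m + b i) = 0}"
proof -
  have "finite {m::nat. a i * int m + b i = 0}" if "i \<in> I" for i
  proof -
    have "m = m'" if "a i * int m + b i = 0" "a i * int m' + b i = 0" for m m' :: nat
    proof -
      have "a i * int m = a i * int m'" using that by linarith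
      then show ?thesis using assms(2)[OF \<open>i \<in> I\<close>] by simp
    qed
    then have "{m::nat. a i * int m + b i = 0} \<subseteq> {m}" if "a i * int m + b i = 0" for m :: nat
      using that by blast
    then show ?thesis by (cases "\<exists>m::nat. a i * int m + b i = 0") (auto intro: finite_subset)
  qed
  moreover have "{m::nat. (\<Prod>i\<in>I. a i * int m + b i) = 0} =
      (\<Union>i\<in>I. {m. a i * int m + b i = 0})"
    using assms(1) by auto
  ultimately show ?thesis using assms(1) by simp
qed

lemma non_terminating_if_unbounded:
  fixes F :: "nat \<Rightarrow> int"
  assumes p: "prime p" and fin: "finite {m. F m = 0}"
    and dvd: "\<And>N. N \<ge> length d \<Longrightarrow> \<exists>m\<in>node_indices p d. int p ^ N dvd F m"
  shows "non_terminating p (\<lambda>n. of_int (F n)) d"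
proof -
  have "p > 0" using p by (simp add: prime_gt_0_nat)
  then have "\<not> node_indices p d \<subseteq> {m. F m = 0}"
    using infinite_node_indices fin finite_subset by blast
  then obtain m where m: "m \<in> node_indices p d" "F m \<noteq> 0" by blast
  define N where "N = length d + multiplicity (int p) (F m) + 1"
  obtain m' where m': "m' \<in> node_indices p d" "int p ^ N dvd F m'"
    using dvd[of N] unfolding N_def by auto
  have "multiplicity (int p) (F m') \<ge> N" if "F m' \<noteq> 0"
    using m'(2) that p by (intro multiplicity_geI) auto
  then have "padic_val p (of_int (F m)) \<noteq> padic_val p (of_int (F m'))"
    using m(2) by (auto simp: padic_val_of_int N_def)
  then show ?thesis using m(1) m'(1) unfolding non_terminating_def by blast
qed

lemma constant_valuation_node:
  assumes "\<And>m. m \<in> node_indices p d \<Longrightarrow> padic_val p (S m) = v"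
  shows "terminating p S d" "node_valuation p S d = v"
proof -
  show "terminating p S d" using assms unfolding terminating_def by simp
  have "\<exists>m. m \<in> node_indices p d" unfolding node_indices_def by blast
  then show "node_valuation p S d = v"
    unfolding node_valuation_def using assms by (intro the_equality) auto
qed

section \<open>Nodes of a product of linear factors\<close>

theorem theorem5p2:
  fixes p r k :: nat
    and a b :: "nat \<Rightarrow> int"
    and c :: "nat \<Rightarrow> nat \<Rightarrow> nat"
    and f :: "nat \<Rightarrow> rat"
    and d :: "nat list"
  assumes "prime p"
    and "\<And>i. i \<in> {1..r} \<Longrightarrow> a i \<noteq> 0"
    and "\<And>i. i \<in> {1..r} \<Longrightarrow> gcd (a i) (b i) = 1"
    and "\<And>n. f n = (\<Prod>i = 1..r. of_int (a i) * of_nat n + of_int (b i))"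
    and "\<And>i. i \<in> {1..r} \<Longrightarrow> padic_integer p (- (of_int (b i) / of_int (a i)))"
    and "\<And>i. i \<in> {1..r} \<Longrightarrow> padic_expansion p (- (of_int (b i) / of_int (a i))) (c i)"
    and "d \<in> valuation_tree p f"
    and "length d = k"
  shows "((\<exists>i\<in>{1..r}. \<not> (\<exists>j<k. d ! j \<noteq> c i j)) \<longrightarrow> non_terminating p f d) \<and>
         ((\<forall>i\<in>{1..r}. \<exists>j<k. d ! j \<noteq> c i j) \<longrightarrow>
            terminating p f d \<and>
            node_valuation p f d =
              Fin (int (\<Sum>i = 1..r. LEAST j. j < k \<and> d ! j \<noteq> c i j)))"
proof -
  note p = assms(1) and a = assms(2) and tree = assms(7) and k = assms(8)
  define F where "F = (\<lambda>n. \<Prod>i = 1..r. a i * int n + b i)"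
  have f: "f = (\<lambda>n. of_int (F n))"
    using assms(4) by (simp add: F_def fun_eq_iff)
  have root: "int p ^ N dvd a i * int (\<Sum>j<N. c i j * p ^ j) + b i" if "i \<in> {1..r}" for i N
    using padic_expansion_root_power_dvd[OF p a assms(6)] that by blast
  show ?thesis
  proof (intro conjI impI)
    assume "\<exists>i\<in>{1..r}. \<not> (\<exists>j<k. d ! j \<noteq> c i j)"
    then obtain i where i: "i \<in> {1..r}" and agree: "\<And>j. j < k \<Longrightarrow> d ! j = c i j" by blast
    show "non_terminating p f d"
      unfolding f
    proof (rule non_terminating_if_unbounded[OF p])
      show "finite {m. F m = 0}"
        unfolding F_def using a by (intro finite_zeros_linear_product) auto
      fix N assume N: "N \<ge> length d"
      have "(a i * int m + b i) dvd F m" for m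
        unfolding F_def using i by (intro dvd_prodI) auto
      then have "int p ^ N dvd F (\<Sum>j<N. c i j * p ^ j)"
        using root[OF i] dvd_trans by blast
      moreover have "(\<Sum>j<N. c i j * p ^ j) \<in> node_indices p d"
        using agree k N by (intro digit_sum_in_node) auto
      ultimately show "\<exists>m\<in>node_indices p d. int p ^ N dvd F m" by blast
    qed
  next
    define v where "v = (\<lambda>i. LEAST j. j < k \<and> d ! j \<noteq> c i j)"
    assume mismatch: "\<forall>i\<in>{1..r}. \<exists>j<k. d ! j \<noteq> c i j"
    have factor: "a i * int m + b i \<noteq> 0 \<and> multiplicity (int p) (a i * int m + b i) = v i"
      if i: "i \<in> {1..r}" and m: "m \<in> node_indices p d" for i m
    proof -
      have v: "v i < k" "d ! v i \<noteq> c i (v i)"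
        using LeastI_ex[of "\<lambda>j. j < k \<and> d ! j \<noteq> c i j"] mismatch i unfolding v_def by auto
      have before: "d ! j = c i j" if "j < v i" for j
        using not_less_Least[of j "\<lambda>j. j < k \<and> d ! j \<noteq> c i j"] that v(1) unfolding v_def by auto
      have pa: "\<not> int p dvd a i"
        using padic_integer_fraction_not_dvd[OF p a assms(3) assms(5)] i by blast
      have digit: "c i (v i) < p"
        using assms(6)[OF i] by (simp add: padic_expansion_def)
      have "d ! v i < p"
        using digits_less_if_in_valuation_tree[OF tree] v(1) k by simp
      then show ?thesis
        using multiplicity_linear_first_mismatch[OF p pa root[OF i] digit _ _ v(2) before m]
          v(1) k by simp
    qed
    have "padic_val p (f m) = Fin (int (\<Sum>i = 1..r. v i))" if m: "m \<in> node_indices p d" for m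
    proof -
      have nz: "F m \<noteq> 0" using factor[OF _ m] by (simp add: F_def)
      have "multiplicity (int p) (F m) = (\<Sum>i = 1..r. multiplicity (int p) (a i * int m + b i))"
        unfolding F_def using p factor[OF _ m]
        by (intro prime_elem_multiplicity_prod_distrib) auto
      also have "\<dots> = (\<Sum>i = 1..r. v i)"
        using factor[OF _ m] by (intro sum.cong) auto
      finally show ?thesis using nz by (simp add: f padic_val_of_int)
    qed
    then show "terminating p f d"
      "node_valuation p f d = Fin (int (\<Sum>i = 1..r. LEAST j. j < k \<and> d ! j \<noteq> c i j))"
      using constant_valuation_node[of p d f] unfolding v_def by blast+
  qed
qed

end
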